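(* In the hyperbolic Pascal triangle linked to $\{4,5\}$, let $s_n$ be the number of elements of row $n$ and let $T(n,i)$ ($0\le i\le s_n-1$) be the $i$-th element of row $n$. Put $$\widetilde s_n=\sum_{i=0}^{s_n-1}(-1)^i\,T(n,i).$$ Then $$\widetilde s_n=\begin{cases}0 & \text{if } n=3t+1 \text{ for some integer } t,\ n\ge1,\\ 2 & \text{if } n\ne 3t+1 \text{ for all integers } t,\ n\ge5,\end{cases}$$ and further $\widetilde s_0=1$, $\widetilde s_2=0$, $\widetilde s_3=-2$.
   Context: The hyperbolic Pascal triangle linked to $\{4,5\}$ is built on an infinite graph ${\mathcal I}_{4,5}$ (cut out of the regular hyperbolic mosaic with Schläfli symbol $\{4,5\}$), whose vertices are arranged in rows $0,1,2,\dots$, each row ordered from left to right, and whose edges join only vertices of consecutive rows. It is constructed as follows. Row $0$ consists of a single vertex $V_0$. Row $1$ consists of two vertices, both joined to $V_0$. For every $j\ge1$ the leftmost and rightmost vertices of row $j$ are called wingers; every other vertex has type $A$ or type $B$. Given row $j\ge 1$, row $j+1$ is obtained by drawing from each vertex of row $j$, in left-to-right order, downward edges: $2$ from a winger, $3$ from a vertex of type $A$, $4$ from a vertex of type $B$. For any two neighbouring vertices of row $j$, the last downward edge of the left one and the first downward edge of the right one end in one common vertex of row $j+1$, which has type $A$. Each of the remaining downward edges ends in its own separate vertex of row $j+1$; among these, the end of the first edge of the leftmost vertex and the end of the last edge of the rightmost vertex are the wingers of row $j+1$, and all the others have type $B$. The left-to-right order of row $j+1$ is the order of the edges. Each vertex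 is labelled by the number of distinct shortest paths from $V_0$ to it; equivalently, $V_0$ has label $1$ and the label of any other vertex is the sum of the labels of its (one or two) neighbours in the previous row. $T(n,k)$ denotes the label of the $k$-th element of row $n$ counted from the left, starting with $k=0$. (For example, row $3$ is $1,3,2,3,1$.) Here $s_0=1$. *)

theory Defs
  imports Main
begin

text \<open>\<open>Root\<close> is the type of the vertex \<open>V\<^sub>0\<close> of row 0, which is neither a winger nor of type A or B.\<close>

datatype vtype = Root | Winger | TypeA | TypeB

fun down_degree :: "vtype \<Rightarrow> nat" where
  "down_degree Root = 2"
| "down_degree Winger = 2"
| "down_degree TypeA = 3"
| "down_degree TypeB = 4"

text \<open>Types of all vertices of the next row except its two wingers. A vertex with \<open>d\<close> downward
  edges has \<open>d - 2\<close> edges other than its first and last one, each ending in a vertex of type B;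
  the shared end between two neighbouring vertices has type A.\<close>

fun inner_types :: "vtype list \<Rightarrow> vtype list" where
  "inner_types [] = []"
| "inner_types [v] = replicate (down_degree v - 2) TypeB"
| "inner_types (v # w # vs) =
     replicate (down_degree v - 2) TypeB @ TypeA # inner_types (w # vs)"

definition next_row :: "vtype list \<Rightarrow> vtype list" where
  "next_row vs = Winger # inner_types vs @ [Winger]"

text \<open>The types of the vertices of each row, from left to right; the rows are
  \<open>[Root]\<close>, \<open>[Winger, Winger]\<close>, \<open>[Winger, TypeA, Winger]\<close>, \<open>\<dots>\<close>\<close>

primrec row :: "nat \<Rightarrow> vtype list" where
  "row 0 = [Root]"
| "row (Suc n) = next_row (row n)"

definition row_size :: "nat \<Rightarrow> nat" where
  "row_size n = length (row n)"

text \<open>The vertex \<open>(n, k)\<close> is the \<open>k\<close>-th vertex of row \<open>n\<close>, counted from 0. The position in row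
  \<open>n + 1\<close> of the end of the first downward edge of \<open>(n, i)\<close>: each vertex to the left of \<open>(n, i)\<close>
  with \<open>d\<close> downward edges moves it by \<open>d - 1\<close>, as its last edge has the same end as the first edge
  of its right neighbour.\<close>

definition first_child :: "nat \<Rightarrow> nat \<Rightarrow> nat" where
  "first_child n i = (\<Sum>j<i. down_degree (row n ! j) - 1)"

definition down_edge :: "nat \<times> nat \<Rightarrow> nat \<times> nat \<Rightarrow> bool" where
  "down_edge u v \<longleftrightarrow>
     (\<exists>n i e. i < row_size n \<and> e < down_degree (row n ! i) \<and>
              u = (n, i) \<and> v = (Suc n, first_child n i + e))"

definition adjacent :: "nat \<times> nat \<Rightarrow> nat \<times> nat \<Rightarrow> bool" where
  "adjacent u v \<longleftrightarrow> down_edge u v \<or> down_edge v u"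

definition is_path :: "nat \<times> nat \<Rightarrow> nat \<times> nat \<Rightarrow> (nat \<times> nat) list \<Rightarrow> bool" where
  "is_path u v p \<longleftrightarrow> p \<noteq> [] \<and> hd p = u \<and> last p = v \<and> successively adjacent p"

definition shortest_paths :: "nat \<times> nat \<Rightarrow> nat \<times> nat \<Rightarrow> (nat \<times> nat) list set" where
  "shortest_paths u v =
     {p. is_path u v p \<and> (\<forall>q. is_path u v q \<longrightarrow> length p \<le> length q)}"

definition T :: "nat \<Rightarrow> nat \<Rightarrow> nat" where
  "T n k = card (shortest_paths (0, 0) (n, k))"

definition alt_sum :: "nat \<Rightarrow> int" where
  "alt_sum n = (\<Sum>i<row_size n. (- 1) ^ i * int (T n i))"

end

theory Submission imports Defs begin

text \<open>
  Every label is the sum of the labels of the parents, so a signed sum of labels over row \<open>n + 1\<close>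
  is a signed sum over row \<open>n\<close>, in which a vertex is weighted by the sum of the signs of its
  children (\<open>sum_row_Suc\<close>). Consecutive children have alternating signs in the sum over row
  \<open>n + 1\<close>, so that only vertices with an odd number of children, those of type A, survive:
  \<open>alt_sum (n + 1)\<close> is the sum over the vertices of type A in row \<open>n\<close>, with the sign given by the
  position of the first child (\<open>alt_sum_Suc\<close>).

  The same transfer is applied to the two types separately. Let \<open>A\<close> and \<open>B\<close> be the parts of
  \<open>alt_sum n\<close> that belong to the vertices of type A and B, and \<open>W\<close> the part of the two wingers, so
  that \<open>alt_sum n = W + A + B\<close> for \<open>n \<ge> 1\<close>. A vertex of type B has two children of type B, whose
  signs cancel, and a vertex of type A has one, between its two other children. Hence
  \<open>B = - alt_sum n\<close> (\<open>B_sum_Suc\<close>), and so \<open>A + 2 B = - W\<close>.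

  On the other hand, \<open>alt_sum (n + 3)\<close> is a signed sum over the vertices of type A in row
  \<open>n + 2\<close>. Each lies between two neighbours of row \<open>n + 1\<close>, and its sign depends on the number of
  vertices of type A to its left there. A vertex of type A in row \<open>n + 1\<close> changes this sign from
  its left edge to its right edge and drops out, a vertex of type B counts twice, and the wingers
  contribute \<open>- W\<close> (\<open>A_sum_by_first_child_Suc_Suc\<close>). The number of vertices of type A to the left of
  a vertex of type B in row \<open>n + 1\<close> is the position of its parent in row \<open>n\<close>
  (\<open>left_As_child\<close>), so the sum over type B is \<open>A + 2 B\<close>. Altogether
  \<open>alt_sum (n + 3) = - 2 (A + 2 B) - W = W\<close> for \<open>n \<ge> 1\<close>.

  Finally \<open>W\<close> is 0 or 2 according to whether row \<open>n\<close> has even or odd length, and modulo 2 the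
  lengths satisfy the Fibonacci recurrence, whose period is 3 (\<open>even_row_size_iff\<close>).
\<close>

section \<open>The shape of the rows\<close>

lemma row_Suc: "row (Suc n) = Winger # inner_types (row n) @ [Winger]"
  by (simp add: next_row_def)

\<comment> \<open>Keeps \<open>row (Suc n)\<close> folded, since the later facts describe its entries through positions.\<close>
declare row.simps(2) [simp del]

lemma down_degree_ge_2: "2 \<le> down_degree v"
  by (cases v) auto

lemma first_child_Suc:
  "first_child n (Suc i) = first_child n i + (down_degree (row n ! i) - 1)"
  by (simp add: first_child_def)

lemma first_child_0 [simp]: "first_child n 0 = 0"
  by (simp add: first_child_def)

lemma strict_mono_first_child: "strict_mono (first_child n)"
  unfolding strict_mono_Suc_iff
proof
  fix i
  show "first_child n i < first_child n (Suc i)"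
    using down_degree_ge_2[of "row n ! i"] by (simp add: first_child_Suc)
qed

text \<open>The \<open>length vs - 1\<close> pairs of neighbours share an end each, so the downward edges have
  one end more than the sum on the right; two of these ends are wingers.\<close>

lemma length_inner_types:
  "vs \<noteq> [] \<Longrightarrow> Suc (length (inner_types vs)) = (\<Sum>j<length vs. down_degree (vs ! j) - 1)"
proof (induction vs rule: inner_types.induct)
  case (2 v)
  then show ?case using down_degree_ge_2[of v] by simp
next
  case (3 v w vs)
  have "(\<Sum>j<length (v # w # vs). down_degree ((v # w # vs) ! j) - 1) =
        (down_degree v - 1) + (\<Sum>j<length (w # vs). down_degree ((w # vs) ! j) - 1)"
    by (simp only: length_Cons sum.lessThan_Suc_shift) simp
  with 3 show ?case using down_degree_ge_2[of v] by simp
qed simp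

text \<open>Positions in the next row are \<open>first_child + e\<close> with the left winger at
  position 0. Without the left winger they move down by one, hence \<open>e < d - 2\<close> here for the middle
  edges of a vertex with \<open>d\<close> downward edges.\<close>

lemma inner_types_nth_TypeB:
  assumes "i < length vs" "e < down_degree (vs ! i) - 2"
  shows "inner_types vs ! ((\<Sum>j<i. down_degree (vs ! j) - 1) + e) = TypeB"
  using assms
proof (induction vs arbitrary: i rule: inner_types.induct)
  case (3 v w vs)
  show ?case
  proof (cases i)
    case 0
    then show ?thesis using 3 by (simp add: nth_append)
  next
    case (Suc i')
    have "(\<Sum>j<i. down_degree ((v # w # vs) ! j) - 1) =
          Suc (down_degree v - 2) + (\<Sum>j<i'. down_degree ((w # vs) ! j) - 1)"
      using Suc down_degree_ge_2[of v] by (simp only: sum.lessThan_Suc_shift) simp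
    moreover have "inner_types (w # vs) ! ((\<Sum>j<i'. down_degree ((w # vs) ! j) - 1) + e) = TypeB"
      using 3 Suc by simp
    ultimately show ?thesis by (simp add: nth_append)
  qed
qed auto

lemma inner_types_nth_TypeA:
  assumes "Suc i < length vs"
  shows "inner_types vs ! ((\<Sum>j<i. down_degree (vs ! j) - 1) + (down_degree (vs ! i) - 2)) = TypeA"
  using assms
proof (induction vs arbitrary: i rule: inner_types.induct)
  case (3 v w vs)
  show ?case
  proof (cases i)
    case 0
    then show ?thesis using 3 by (simp add: nth_append)
  next
    case (Suc i')
    have "(\<Sum>j<i. down_degree ((v # w # vs) ! j) - 1) =
          Suc (down_degree v - 2) + (\<Sum>j<i'. down_degree ((w # vs) ! j) - 1)"
      using Suc down_degree_ge_2[of v] by (simp only: sum.lessThan_Suc_shift) simp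
    moreover have "inner_types (w # vs) ! ((\<Sum>j<i'. down_degree ((w # vs) ! j) - 1)
        + (down_degree ((w # vs) ! i') - 2)) = TypeA"
      using 3 Suc by simp
    ultimately show ?thesis using Suc by (simp add: nth_append)
  qed
qed auto

lemma row_nonempty: "row n \<noteq> []"
  by (cases n) (auto simp: row_Suc)

lemma row_size_pos: "0 < row_size n"
  using row_nonempty by (simp add: row_size_def)

lemma row_size_Suc: "row_size (Suc n) = Suc (first_child n (row_size n))"
  using length_inner_types[OF row_nonempty, of n]
  by (simp add: row_size_def row_Suc first_child_def)

lemma row_size_Suc_ge_2: "2 \<le> row_size (Suc n)"
  by (simp add: row_size_def row_Suc)

lemma row_Suc_0: "row (Suc n) ! 0 = Winger"
  by (simp add: row_Suc)

lemma row_Suc_last: "row (Suc n) ! first_child n (row_size n) = Winger"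
proof -
  have "first_child n (row_size n) = Suc (length (inner_types (row n)))"
    using row_size_Suc[of n] by (simp add: row_size_def row_Suc)
  then show ?thesis by (simp add: row_Suc nth_append)
qed

lemma row_Suc_inner_child:
  assumes "i < row_size n" "0 < e" "e < down_degree (row n ! i) - 1"
  shows "row (Suc n) ! (first_child n i + e) = TypeB"
proof -
  have "first_child n i + e < first_child n (Suc i)"
    using assms by (simp add: first_child_Suc)
  also have "\<dots> \<le> first_child n (row_size n)"
    using assms by (simp add: strict_mono_less_eq[OF strict_mono_first_child])
  finally have "first_child n i + (e - 1) < length (inner_types (row n))"
    using assms length_inner_types[OF row_nonempty, of n]
    by (simp add: row_size_def first_child_def)
  then show ?thesis
    using inner_types_nth_TypeB[of i "row n" "e - 1"] assms
    by (cases e) (auto simp: row_Suc nth_append first_child_def row_size_def)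
qed

lemma row_Suc_shared_child:
  assumes "Suc i < row_size n"
  shows "row (Suc n) ! first_child n (Suc i) = TypeA"
proof -
  have eq: "first_child n (Suc i) = Suc (first_child n i + (down_degree (row n ! i) - 2))"
    using down_degree_ge_2[of "row n ! i"] by (simp add: first_child_Suc)
  have "first_child n (Suc i) < first_child n (row_size n)"
    using assms by (simp add: strict_mono_less[OF strict_mono_first_child])
  then have "first_child n i + (down_degree (row n ! i) - 2) < length (inner_types (row n))"
    using eq length_inner_types[OF row_nonempty, of n]
    by (simp add: row_size_def first_child_def)
  then show ?thesis
    using inner_types_nth_TypeA[of i "row n"] assms
    unfolding eq by (simp add: row_Suc nth_append first_child_def row_size_def)
qed

text \<open>The condition \<open>0 < e\<close> attributes a shared child to its left parent, as the end of the
  last edge. Only the left winger is the end of a first edge and of no other.\<close>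

lemma first_child_cover:
  assumes "0 < k" "k \<le> first_child n m"
  obtains i e where "i < m" "0 < e" "e < down_degree (row n ! i)" "k = first_child n i + e"
  using assms
proof (induction m arbitrary: thesis)
  case (Suc m)
  show ?case
  proof (cases "k \<le> first_child n m")
    case True
    then show ?thesis using Suc by (metis less_Suc_eq)
  next
    case False
    then show ?thesis
      using Suc.prems(1)[of m "k - first_child n m"] Suc.prems(3) by (auto simp: first_child_Suc)
  qed
qed simp

lemma row_Suc_inner_type:
  assumes "0 < k" "Suc k < row_size (Suc n)"
  shows "row (Suc n) ! k \<in> {TypeA, TypeB}"
proof -
  have k: "k < first_child n (row_size n)"
    using assms by (simp add: row_size_Suc)
  then obtain i e where ie: "i < row_size n" "0 < e" "e < down_degree (row n ! i)"
      "k = first_child n i + e"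
    using first_child_cover[of k n "row_size n"] assms by auto
  show ?thesis
  proof (cases "e < down_degree (row n ! i) - 1")
    case True
    then show ?thesis using row_Suc_inner_child ie by simp
  next
    case False
    then have "k = first_child n (Suc i)" using ie by (simp add: first_child_Suc)
    then show ?thesis using k row_Suc_shared_child
      by (simp add: strict_mono_less[OF strict_mono_first_child])
  qed
qed


section \<open>Labels as sums over parents\<close>

text \<open>Two vertices are joined by at most one edge, so a set of parents suffices to count
  paths.\<close>

definition parents :: "nat \<Rightarrow> nat \<Rightarrow> nat set" where
  "parents n k = {i. i < row_size n \<and> (\<exists>e<down_degree (row n ! i). k = first_child n i + e)}"

lemma down_edge_Suc_iff: "down_edge (n, i) (Suc n, k) \<longleftrightarrow> i \<in> parents n k"
  by (auto simp: down_edge_def parents_def)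

lemma adjacent_fst: "adjacent u v \<Longrightarrow> fst v = Suc (fst u) \<or> fst u = Suc (fst v)"
  by (auto simp: adjacent_def down_edge_def)

text \<open>Every edge changes the row by one, so a path that starts in row 0 must have at least
  one vertex in each row down to its end.\<close>

lemma path_length_ge:
  assumes "is_path (0, 0) v p"
  shows "fst v < length p"
proof -
  have "successively adjacent p \<Longrightarrow> p \<noteq> [] \<Longrightarrow> fst (hd p) = 0 \<Longrightarrow> fst (last p) < length p"
  proof (induction p rule: rev_induct)
    case (snoc v p)
    then show ?case
      by (cases "p = []") (auto simp: successively_append_iff hd_append dest!: adjacent_fst)
  qed simp
  then show ?thesis using assms by (auto simp: is_path_def)
qed

text \<open>These turn out to be the shortest paths to the vertices of the triangle. Fixing the
  length instead of minimising it makes the recursion along the last edge immediate.\<close>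

definition minimal_paths :: "nat \<Rightarrow> nat \<Rightarrow> (nat \<times> nat) list set" where
  "minimal_paths n k = {p. is_path (0, 0) (n, k) p \<and> length p = Suc n}"

lemma minimal_paths_0: "minimal_paths 0 k = (if k = 0 then {[(0, 0)]} else {})"
  by (auto simp: minimal_paths_def is_path_def length_Suc_conv)

text \<open>A path of this length has no room for a step upwards: by \<open>path_length_ge\<close> its last
  vertex but one cannot lie below row \<open>n\<close>, and it lies in a row next to row \<open>n + 1\<close>.\<close>

lemma minimal_paths_Suc:
  "minimal_paths (Suc n) k =
    (\<Union>i\<in>parents n k. (\<lambda>q. q @ [(Suc n, k)]) ` minimal_paths n i)" (is "_ = ?R")
proof (intro equalityI subsetI)
  fix p assume "p \<in> minimal_paths (Suc n) k"
  then have p: "is_path (0, 0) (Suc n, k) p" "length p = Suc (Suc n)"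
    by (auto simp: minimal_paths_def)
  then obtain q where q: "p = q @ [(Suc n, k)]" "length q = Suc n"
    by (cases p rule: rev_cases) (auto simp: is_path_def)
  then have ne: "q \<noteq> []" by auto
  have path: "is_path (0, 0) (last q) q" and adj: "adjacent (last q) (Suc n, k)"
    using p q ne by (auto simp: is_path_def successively_append_iff)
  have "fst (last q) = n"
    using path_length_ge[OF path] adjacent_fst[OF adj] q by auto
  then obtain i where i: "last q = (n, i)" by (cases "last q") auto
  have "i \<in> parents n k"
    using adj unfolding i down_edge_Suc_iff[symmetric] by (auto simp: adjacent_def down_edge_def)
  then show "p \<in> ?R"
    using path i q by (auto simp: minimal_paths_def)
next
  fix p assume "p \<in> ?R"
  then show "p \<in> minimal_paths (Suc n) k"
    by (auto simp: minimal_paths_def is_path_def successively_append_iff adjacent_def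
        down_edge_Suc_iff hd_append)
qed

lemma finite_parents: "finite (parents n k)"
  by (simp add: parents_def)

lemma finite_minimal_paths: "finite (minimal_paths n k)"
  by (induction n arbitrary: k) (simp_all add: minimal_paths_0 minimal_paths_Suc finite_parents)

lemma parents_nonempty:
  assumes "k < row_size (Suc n)"
  shows "parents n k \<noteq> {}"
proof (cases "k = 0")
  case True
  have "0 \<in> parents n k"
    unfolding parents_def using True row_size_pos[of n] down_degree_ge_2[of "row n ! 0"]
    by (auto intro!: exI[of _ 0])
  then show ?thesis by auto
next
  case False
  then have "0 < k" "k \<le> first_child n (row_size n)"
    using assms by (simp_all add: row_size_Suc)
  then obtain i e where "i < row_size n" "e < down_degree (row n ! i)" "k = first_child n i + e"
    by (rule first_child_cover)
  then have "i \<in> parents n k" by (auto simp: parents_def)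
  then show ?thesis by auto
qed

lemma minimal_paths_nonempty: "k < row_size n \<Longrightarrow> minimal_paths n k \<noteq> {}"
proof (induction n arbitrary: k)
  case 0
  then show ?case by (simp add: minimal_paths_0 row_size_def)
next
  case (Suc n)
  then obtain i where "i \<in> parents n k" using parents_nonempty by blast
  then show ?case using Suc.IH[of i] by (auto simp: minimal_paths_Suc parents_def)
qed

lemma T_eq_card_minimal_paths:
  assumes "k < row_size n"
  shows "T n k = card (minimal_paths n k)"
proof -
  obtain p where "p \<in> minimal_paths n k" using minimal_paths_nonempty[OF assms] by blast
  then have "shortest_paths (0, 0) (n, k) = minimal_paths n k"
    unfolding shortest_paths_def minimal_paths_def
    by (force dest: path_length_ge intro: antisym)
  then show ?thesis by (simp add: T_def)
qed

lemma T_Suc: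
  assumes "k < row_size (Suc n)"
  shows "T (Suc n) k = (\<Sum>i\<in>parents n k. T n i)"
proof -
  have "T (Suc n) k = card (\<Union>i\<in>parents n k. (\<lambda>q. q @ [(Suc n, k)]) ` minimal_paths n i)"
    using T_eq_card_minimal_paths[OF assms] by (simp add: minimal_paths_Suc)
  also have "\<dots> = (\<Sum>i\<in>parents n k. card ((\<lambda>q. q @ [(Suc n, k)]) ` minimal_paths n i))"
  proof (rule card_UN_disjoint)
    show "\<forall>i\<in>parents n k. \<forall>j\<in>parents n k. i \<noteq> j \<longrightarrow>
        (\<lambda>q. q @ [(Suc n, k)]) ` minimal_paths n i \<inter> (\<lambda>q. q @ [(Suc n, k)]) ` minimal_paths n j = {}"
      by (auto simp: minimal_paths_def is_path_def)
  qed (simp_all add: finite_parents finite_minimal_paths)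
  also have "\<dots> = (\<Sum>i\<in>parents n k. T n i)"
    by (rule sum.cong) (auto simp: card_image inj_on_def T_eq_card_minimal_paths parents_def)
  finally show ?thesis .
qed

text \<open>This duality carries the whole proof: a weighted sum over row \<open>n + 1\<close> becomes a sum
  over row \<open>n\<close> by counting each edge at its upper end.\<close>

lemma sum_row_Suc:
  fixes f :: "nat \<Rightarrow> int"
  shows "(\<Sum>k<row_size (Suc n). f k * int (T (Suc n) k)) =
    (\<Sum>i<row_size n. (\<Sum>e<down_degree (row n ! i). f (first_child n i + e)) * int (T n i))"
proof -
  \<comment> \<open>The positions of the children of vertex \<open>i\<close>.\<close>
  define C where "C i = (\<lambda>e. first_child n i + e) ` {..<down_degree (row n ! i)}" for i
  have C_sub: "C i \<subseteq> {..<row_size (Suc n)}" if "i < row_size n" for i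
  proof -
    have "first_child n (Suc i) \<le> first_child n (row_size n)"
      using that by (simp add: strict_mono_less_eq[OF strict_mono_first_child])
    then show ?thesis by (auto simp: C_def row_size_Suc first_child_Suc)
  qed
  have "(\<Sum>k<row_size (Suc n). f k * int (T (Suc n) k)) =
      (\<Sum>k<row_size (Suc n). \<Sum>i<row_size n. if k \<in> C i then f k * int (T n i) else 0)"
  proof (rule sum.cong)
    fix k assume "k \<in> {..<row_size (Suc n)}"
    then have "f k * int (T (Suc n) k) = (\<Sum>i\<in>parents n k. f k * int (T n i))"
      by (simp add: T_Suc sum_distrib_left)
    also have "parents n k = {i \<in> {..<row_size n}. k \<in> C i}"
      by (auto simp: parents_def C_def)
    also have "(\<Sum>i\<in>\<dots>. f k * int (T n i)) =
        (\<Sum>i<row_size n. if k \<in> C i then f k * int (T n i) else 0)"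
      by (rule sum.inter_filter) simp
    finally show "f k * int (T (Suc n) k) =
        (\<Sum>i<row_size n. if k \<in> C i then f k * int (T n i) else 0)" .
  qed simp
  also have "\<dots> = (\<Sum>i<row_size n. \<Sum>k<row_size (Suc n). if k \<in> C i then f k * int (T n i) else 0)"
    by (rule sum.swap)
  also have "\<dots> = (\<Sum>i<row_size n. (\<Sum>e<down_degree (row n ! i). f (first_child n i + e)) * int (T n i))"
  proof (rule sum.cong)
    fix i assume "i \<in> {..<row_size n}"
    then have "{..<row_size (Suc n)} \<inter> C i = C i" using C_sub by auto
    then have "(\<Sum>k<row_size (Suc n). if k \<in> C i then f k * int (T n i) else 0) =
        (\<Sum>k\<in>C i. f k * int (T n i))"
      by (simp flip: sum.inter_restrict)
    also have "\<dots> = (\<Sum>e<down_degree (row n ! i). f (first_child n i + e) * int (T n i))"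
      unfolding C_def by (subst sum.reindex) (auto simp: inj_on_def)
    finally show "(\<Sum>k<row_size (Suc n). if k \<in> C i then f k * int (T n i) else 0) =
        (\<Sum>e<down_degree (row n ! i). f (first_child n i + e)) * int (T n i)"
      by (simp add: sum_distrib_right)
  qed simp
  finally show ?thesis .
qed

lemma T_left_winger: "T n 0 = 1"
proof (induction n)
  case 0
  then show ?case by (simp add: T_eq_card_minimal_paths row_size_def minimal_paths_0)
next
  case (Suc n)
  have "i = 0" if "first_child n i = 0" for i
    using that strict_mono_eq[OF strict_mono_first_child, of n i 0] by simp
  then have "parents n 0 = {0}"
    using row_size_pos[of n] down_degree_ge_2[of "row n ! 0"] by (auto simp: parents_def)
  then show ?case using Suc by (simp add: T_Suc row_size_pos)
qed

lemma T_right_winger: "T n (row_size n - 1) = 1"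
proof (induction n)
  case 0
  then show ?case by (simp add: row_size_def T_left_winger)
next
  case (Suc n)
  define s where "s = row_size n"
  have s: "0 < s" by (simp add: s_def row_size_pos)
  have fc: "first_child n s = first_child n (s - 1) + (down_degree (row n ! (s - 1)) - 1)"
    using s first_child_Suc[of n "s - 1"] by simp
  have "i = s - 1"
    if "i < s" "e < down_degree (row n ! i)" "first_child n s = first_child n i + e" for i e
  proof -
    have "first_child n s \<le> first_child n (Suc i)" using that by (simp add: first_child_Suc)
    then have "s \<le> Suc i" by (simp add: strict_mono_less_eq[OF strict_mono_first_child])
    then show ?thesis using that by simp
  qed
  moreover have "s - 1 \<in> parents n (first_child n s)"
    using s fc down_degree_ge_2[of "row n ! (s - 1)"]
    by (auto simp: parents_def s_def intro!: exI[of _ "down_degree (row n ! (row_size n - 1)) - 1"])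
  ultimately have "parents n (first_child n s) = {s - 1}"
    by (auto simp: parents_def s_def)
  then show ?case using Suc by (simp add: T_Suc row_size_Suc s_def)
qed


section \<open>Parities of positions\<close>

definition left_As :: "nat \<Rightarrow> nat \<Rightarrow> nat" where
  "left_As n k = (\<Sum>j<k. of_bool (row n ! j = TypeA))"

lemma left_As_Suc: "left_As n (Suc k) = left_As n k + of_bool (row n ! k = TypeA)"
  by (simp add: left_As_def)

text \<open>A vertex to the left moves the first child by an odd number, unless it has type A.\<close>

lemma first_child_sign: "(- 1 :: int) ^ first_child n i = (- 1) ^ (i + left_As n i)"
proof (induction i)
  case 0
  then show ?case by (simp add: left_As_def)
next
  case (Suc i)
  then show ?case
    by (cases "row n ! i") (simp_all add: first_child_Suc left_As_Suc power_add)
qed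

text \<open>Read from left to right, row \<open>n + 1\<close> has exactly one vertex of type A between the
  middle children of any two neighbours of row \<open>n\<close>; the children with \<open>0 < e\<close> of vertex \<open>i\<close> thus
  have \<open>i\<close> vertices of type A to their left.\<close>

lemma left_As_child:
  assumes "i < row_size n" "0 < e" "e < down_degree (row n ! i)"
  shows "left_As (Suc n) (first_child n i + e) = i"
proof -
  \<comment> \<open>Within the children of one vertex the count stays constant until after the last one.\<close>
  have step: "left_As (Suc n) (first_child n i + e) = i"
    if start: "left_As (Suc n) (Suc (first_child n i)) = i" and i: "i < row_size n"
      and "0 < e" "e < down_degree (row n ! i)" for i e
    using that(3,4)
  proof (induction e)
    case (Suc e)
    show ?case
    proof (cases "e = 0")
      case True
      then show ?thesis using start by simp
    next
      case False
      then show ?thesis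
        using Suc row_Suc_inner_child[OF i, of e] by (simp add: left_As_Suc)
    qed
  qed simp
  have "left_As (Suc n) (Suc (first_child n i)) = i" using assms(1)
  proof (induction i)
    case 0
    then show ?case by (simp add: left_As_Suc row_Suc_0) (simp add: left_As_def)
  next
    case (Suc i)
    have "left_As (Suc n) (first_child n (Suc i)) = i"
      unfolding first_child_Suc
      using step[of i "down_degree (row n ! i) - 1"] Suc down_degree_ge_2[of "row n ! i"] by simp
    then show ?case using row_Suc_shared_child[OF Suc.prems] by (simp add: left_As_Suc)
  qed
  then show ?thesis using step assms by blast
qed

lemma left_As_shared_child:
  assumes "i < row_size n"
  shows "left_As (Suc n) (first_child n (Suc i)) = i"
  using left_As_child[OF assms, of "down_degree (row n ! i) - 1"] down_degree_ge_2[of "row n ! i"]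
  by (simp add: first_child_Suc)

lemma left_As_row_size: "Suc (left_As (Suc n) (row_size (Suc n))) = row_size n"
  using left_As_shared_child[of "row_size n - 1" n] row_size_pos[of n]
  by (simp add: row_size_Suc left_As_Suc row_Suc_last)

text \<open>Modulo 2, the length of row \<open>n + 2\<close> is one more than the sum of the length of row
  \<open>n + 1\<close> and its number of vertices of type A, and the latter correspond to the
  \<open>row_size n - 1\<close> pairs of neighbours in row \<open>n\<close>.\<close>

lemma even_row_size_Suc_Suc:
  "even (row_size (Suc (Suc n))) \<longleftrightarrow> even (row_size (Suc n) + row_size n)"
proof -
  have "even (first_child (Suc n) i) \<longleftrightarrow> even (i + left_As (Suc n) i)" for i
    using first_child_sign[of "Suc n" i] by (auto simp: minus_one_power_iff split: if_splits)
  then have "even (row_size (Suc (Suc n))) \<longleftrightarrow>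
      odd (row_size (Suc n) + left_As (Suc n) (row_size (Suc n)))"
    by (simp add: row_size_Suc[of "Suc n"])
  also have "\<dots> \<longleftrightarrow> even (row_size (Suc n) + Suc (left_As (Suc n) (row_size (Suc n))))"
    by simp
  finally show ?thesis unfolding left_As_row_size .
qed

lemma even_row_size_iff: "even (row_size n) \<longleftrightarrow> n mod 3 = 1"
proof (induction n rule: induct_nat_012)
  case (ge2 n)
  then show ?case
    unfolding even_row_size_Suc_Suc even_add by presburger
qed (simp_all add: row_size_def row_Suc)


section \<open>Signed sums over a row\<close>

definition A_sum_by_first_child :: "nat \<Rightarrow> int" where
  "A_sum_by_first_child n = (\<Sum>i<row_size n. of_bool (row n ! i = TypeA) * (- 1) ^ first_child n i * int (T n i))"

definition B_sum :: "nat \<Rightarrow> int" where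
  "B_sum n = (\<Sum>i<row_size n. of_bool (row n ! i = TypeB) * (- 1) ^ i * int (T n i))"

definition A_sum :: "nat \<Rightarrow> int" where
  "A_sum n = (\<Sum>i<row_size n. of_bool (row n ! i = TypeA) * (- 1) ^ i * int (T n i))"

definition B_sum_by_As :: "nat \<Rightarrow> int" where
  "B_sum_by_As n = (\<Sum>i<row_size n. of_bool (row n ! i = TypeB) * (- 1) ^ left_As n i * int (T n i))"

text \<open>The alternating sum over the children of a vertex vanishes when their number is even.\<close>

lemma alt_sum_Suc: "alt_sum (Suc n) = A_sum_by_first_child n"
  unfolding alt_sum_def A_sum_by_first_child_def sum_row_Suc
proof (rule sum.cong)
  fix i
  show "(\<Sum>e<down_degree (row n ! i). (- 1) ^ (first_child n i + e)) * int (T n i) =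
        of_bool (row n ! i = TypeA) * (- 1) ^ first_child n i * int (T n i)"
    by (cases "row n ! i") (simp_all add: power_add eval_nat_numeral)
qed simp

lemma sum_split_ends:
  fixes h :: "nat \<Rightarrow> int"
  assumes "2 \<le> d"
  shows "(\<Sum>e<d. h e) = h 0 + (\<Sum>e=1..<d-1. h e) + h (d - 1)"
proof -
  obtain c where c: "d = Suc (Suc c)" using assms by (metis add_2_eq_Suc le_Suc_ex)
  have "(\<Sum>e<d. h e) = (\<Sum>e<Suc c. h e) + h (Suc c)" by (simp add: c)
  also have "(\<Sum>e<Suc c. h e) = h 0 + (\<Sum>e=1..<Suc c. h e)"
    by (simp add: lessThan_atLeast0 sum.atLeast_Suc_lessThan)
  finally show ?thesis by (simp add: c)
qed

lemma sum_children_TypeB: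
  fixes g :: "nat \<Rightarrow> int"
  assumes i: "i < row_size n"
  shows "(\<Sum>e<down_degree (row n ! i).
            of_bool (row (Suc n) ! (first_child n i + e) = TypeB) * g (first_child n i + e)) =
         (\<Sum>e=1..<down_degree (row n ! i) - 1. g (first_child n i + e))"
proof -
  have first: "row (Suc n) ! first_child n i \<noteq> TypeB"
    using row_Suc_shared_child[of "i - 1" n] i row_Suc_0[of n] by (cases i) auto
  have last: "row (Suc n) ! first_child n (Suc i) \<noteq> TypeB"
  proof (cases "Suc i = row_size n")
    case True
    then show ?thesis using row_Suc_last[of n] by simp
  next
    case False
    then show ?thesis using row_Suc_shared_child[of i n] i by simp
  qed
  have inner: "row (Suc n) ! (first_child n i + e) = TypeB"
    if "e \<in> {1..<down_degree (row n ! i) - 1}" for e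
    using that row_Suc_inner_child[OF i, of e] by simp
  show ?thesis
    unfolding sum_split_ends[OF down_degree_ge_2] first_child_Suc[symmetric]
    using first last inner by simp
qed

lemma sum_children_TypeA:
  fixes g :: "nat \<Rightarrow> int"
  assumes i: "i < row_size n"
  shows "(\<Sum>e<down_degree (row n ! i).
            of_bool (row (Suc n) ! (first_child n i + e) = TypeA) * g (first_child n i + e)) =
         of_bool (0 < i) * g (first_child n i) +
         of_bool (Suc i < row_size n) * g (first_child n (Suc i))"
proof -
  have first: "row (Suc n) ! first_child n i = TypeA \<longleftrightarrow> 0 < i"
    using row_Suc_shared_child[of "i - 1" n] i row_Suc_0[of n] by (cases i) auto
  have last: "row (Suc n) ! first_child n (Suc i) = TypeA \<longleftrightarrow> Suc i < row_size n"
  proof (cases "Suc i = row_size n")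
    case True
    then show ?thesis using row_Suc_last[of n] by simp
  next
    case False
    then show ?thesis using row_Suc_shared_child[of i n] i by simp
  qed
  have inner: "row (Suc n) ! (first_child n i + e) = TypeB"
    if "e \<in> {1..<down_degree (row n ! i) - 1}" for e
    using that row_Suc_inner_child[OF i, of e] by simp
  show ?thesis
    unfolding sum_split_ends[OF down_degree_ge_2] first_child_Suc[symmetric]
    using first last inner by simp
qed

text \<open>The middle children of a vertex of type B have opposite signs. A vertex of type A has a
  single middle child, one place after its first child, which gives the minus sign.\<close>

lemma B_sum_Suc: "B_sum (Suc n) = - A_sum_by_first_child n"
proof -
  have "B_sum (Suc n) = (\<Sum>i<row_size n.
      (\<Sum>e=1..<down_degree (row n ! i) - 1. (- 1) ^ (first_child n i + e)) * int (T n i))"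
    unfolding B_sum_def sum_row_Suc
    by (rule sum.cong[OF refl], subst sum_children_TypeB) simp_all
  also have "\<dots> = (\<Sum>i<row_size n.
      - (of_bool (row n ! i = TypeA) * (- 1) ^ first_child n i * int (T n i)))"
  proof (rule sum.cong)
    fix i
    show "(\<Sum>e=1..<down_degree (row n ! i) - 1. (- 1) ^ (first_child n i + e)) * int (T n i) =
        - (of_bool (row n ! i = TypeA) * (- 1) ^ first_child n i * int (T n i))"
      by (cases "row n ! i") (simp_all add: power_add numeral_eq_Suc)
  qed simp
  finally show ?thesis by (simp add: A_sum_by_first_child_def sum_negf)
qed

text \<open>All middle children of vertex \<open>i\<close> have \<open>i\<close> vertices of type A to their left: none
  of their signs cancel, in contrast to \<open>B_sum_Suc\<close>.\<close>

lemma B_sum_by_As_Suc: "B_sum_by_As (Suc n) = A_sum n + 2 * B_sum n"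
proof -
  have "B_sum_by_As (Suc n) = (\<Sum>i<row_size n.
      (\<Sum>e=1..<down_degree (row n ! i) - 1. (- 1) ^ i) * int (T n i))"
    unfolding B_sum_by_As_def sum_row_Suc
  proof (rule sum.cong[OF refl])
    fix i assume "i \<in> {..<row_size n}"
    then have i: "i < row_size n" by simp
    have "(\<Sum>e=1..<down_degree (row n ! i) - 1. (- 1 :: int) ^ left_As (Suc n) (first_child n i + e)) =
        (\<Sum>e=1..<down_degree (row n ! i) - 1. (- 1) ^ i)"
      by (rule sum.cong) (auto simp: left_As_child[OF i])
    then show "(\<Sum>e<down_degree (row n ! i). of_bool (row (Suc n) ! (first_child n i + e) = TypeB)
          * (- 1) ^ left_As (Suc n) (first_child n i + e)) * int (T n i) =
        (\<Sum>e=1..<down_degree (row n ! i) - 1. (- 1) ^ i) * int (T n i)"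
      using sum_children_TypeB[OF i, of "\<lambda>k. (- 1) ^ left_As (Suc n) k"] by simp
  qed
  also have "\<dots> = (\<Sum>i<row_size n.
      of_bool (row n ! i = TypeA) * (- 1) ^ i * int (T n i) +
      2 * (of_bool (row n ! i = TypeB) * (- 1) ^ i * int (T n i)))"
  proof (rule sum.cong)
    fix i
    show "(\<Sum>e=1..<down_degree (row n ! i) - 1. (- 1) ^ i) * int (T n i) =
        of_bool (row n ! i = TypeA) * (- 1) ^ i * int (T n i) +
        2 * (of_bool (row n ! i = TypeB) * (- 1) ^ i * int (T n i))"
      by (cases "row n ! i") simp_all
  qed simp
  finally show ?thesis by (simp add: A_sum_def B_sum_def sum.distrib sum_distrib_left)
qed

text \<open>From row 1 on, the wingers are two different vertices, at the two ends.\<close>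

lemma sum_row_by_type:
  fixes f :: "nat \<Rightarrow> int"
  shows "(\<Sum>i<row_size (Suc n). f i) = f 0 + f (row_size (Suc n) - 1) +
    (\<Sum>i<row_size (Suc n). of_bool (row (Suc n) ! i \<in> {TypeA, TypeB}) * f i)"
proof -
  let ?s = "row_size (Suc n)"
  have ends: "row (Suc n) ! 0 = Winger" "row (Suc n) ! (?s - 1) = Winger"
    using row_Suc_0 row_Suc_last by (simp_all add: row_size_Suc)
  have "row (Suc n) ! i \<in> {TypeA, TypeB}" if "i \<in> {1..<?s - 1}" for i
    by (rule row_Suc_inner_type) (use that in auto)
  then have "(\<Sum>i=1..<?s - 1. f i) =
      (\<Sum>i=1..<?s - 1. of_bool (row (Suc n) ! i \<in> {TypeA, TypeB}) * f i)"
    by (intro sum.cong refl) (simp only: of_bool_eq mult_1)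
  then show ?thesis
    unfolding sum_split_ends[OF row_size_Suc_ge_2] using ends by simp
qed

lemma alt_sum_by_type:
  "alt_sum (Suc n) = 1 - (- 1) ^ row_size (Suc n) + A_sum (Suc n) + B_sum (Suc n)"
proof -
  let ?s = "row_size (Suc n)"
  have "alt_sum (Suc n) = 1 + (- 1) ^ (?s - 1) +
      (\<Sum>i<?s. of_bool (row (Suc n) ! i \<in> {TypeA, TypeB}) * ((- 1) ^ i * int (T (Suc n) i)))"
    unfolding alt_sum_def by (subst sum_row_by_type) (simp add: T_left_winger T_right_winger[simplified])
  also have "(- 1 :: int) ^ (?s - 1) = - ((- 1) ^ ?s)"
    by (simp add: row_size_Suc)
  also have "(\<Sum>i<?s. of_bool (row (Suc n) ! i \<in> {TypeA, TypeB}) * ((- 1) ^ i * int (T (Suc n) i)))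
      = A_sum (Suc n) + B_sum (Suc n)"
    unfolding A_sum_def B_sum_def sum.distrib[symmetric] by (rule sum.cong) auto
  finally show ?thesis by simp
qed

text \<open>Each vertex of type A in row \<open>n + 2\<close> is a shared child, so a vertex of row
  \<open>n + 1\<close> contributes through its left edge and its right edge, except at the ends of the row.
  The two signs differ exactly when the vertex has type A itself, so only the wingers and the
  vertices of type B remain.\<close>

lemma A_sum_by_first_child_Suc_Suc:
  "A_sum_by_first_child (Suc (Suc n)) = - 2 * B_sum_by_As (Suc n) - (1 - (- 1) ^ row_size n)"
proof -
  let ?m = "Suc n"
  let ?s = "row_size (Suc n)"
  have sign: "(- 1 :: int) ^ first_child (Suc ?m) (first_child ?m (Suc i)) =
      - ((- 1) ^ left_As ?m (Suc i))" if "i < ?s" for i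
    using left_As_shared_child[OF that]
    by (simp add: first_child_sign[of "Suc ?m"] power_add first_child_sign[of ?m "Suc i"])
  \<comment> \<open>The weight of vertex \<open>i\<close>, up to sign: its left and its right shared child.\<close>
  define w :: "nat \<Rightarrow> int" where
    "w i = of_bool (0 < i) * (- 1) ^ left_As ?m i + of_bool (Suc i < ?s) * (- 1) ^ left_As ?m (Suc i)"
    for i
  have "A_sum_by_first_child (Suc ?m) = (\<Sum>i<?s. - (w i) * int (T ?m i))"
    unfolding A_sum_by_first_child_def
  proof (subst sum_row_Suc, rule sum.cong)
    fix i assume "i \<in> {..<?s}"
    then have i: "i < ?s" by simp
    have left: "of_bool (0 < i) * (- 1 :: int) ^ first_child (Suc ?m) (first_child ?m i) =
        - (of_bool (0 < i) * (- 1) ^ left_As ?m i)"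
      using sign[of "i - 1"] i by (cases i) simp_all
    show "(\<Sum>e<down_degree (row ?m ! i). of_bool (row (Suc ?m) ! (first_child ?m i + e) = TypeA)
          * (- 1) ^ first_child (Suc ?m) (first_child ?m i + e)) * int (T ?m i) =
        - (w i) * int (T ?m i)"
      unfolding sum_children_TypeA[OF i, of "\<lambda>k. (- 1) ^ first_child (Suc ?m) k"] left sign[OF i] w_def
      by (simp add: algebra_simps)
  qed simp
  also have "\<dots> = - (w 0) - w (?s - 1) + (\<Sum>i<?s. of_bool (row ?m ! i \<in> {TypeA, TypeB}) *
      (- (w i) * int (T ?m i)))"
    by (subst sum_row_by_type) (simp add: T_left_winger T_right_winger[simplified])
  also have "(\<Sum>i<?s. of_bool (row ?m ! i \<in> {TypeA, TypeB}) * (- (w i) * int (T ?m i))) =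
      (\<Sum>i<?s. - 2 * (of_bool (row ?m ! i = TypeB) * (- 1) ^ left_As ?m i * int (T ?m i)))"
  proof (rule sum.cong)
    fix i assume i: "i \<in> {..<?s}"
    have "0 < i \<and> Suc i < ?s" if "row ?m ! i \<noteq> Winger"
    proof -
      have "i \<noteq> 0" "i \<noteq> first_child n (row_size n)"
        using that row_Suc_0[of n] row_Suc_last[of n] by metis+
      then show ?thesis using i by (simp add: row_size_Suc)
    qed
    then show "of_bool (row ?m ! i \<in> {TypeA, TypeB}) * (- (w i) * int (T ?m i)) =
        - 2 * (of_bool (row ?m ! i = TypeB) * (- 1) ^ left_As ?m i * int (T ?m i))"
      by (cases "row ?m ! i") (simp_all add: w_def left_As_Suc)
  qed simp
  also have "\<dots> = - 2 * B_sum_by_As ?m"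
    by (simp add: B_sum_by_As_def sum_distrib_left)
  also have "w 0 = 1"
    using row_size_Suc_ge_2[of n] by (simp add: w_def left_As_Suc row_Suc_0) (simp add: left_As_def)
  also have "w (?s - 1) = - ((- 1) ^ row_size n)"
  proof -
    have "w (?s - 1) = (- 1) ^ left_As ?m (?s - 1)"
      using row_size_Suc_ge_2[of n] by (simp add: w_def)
    also have "left_As ?m (?s - 1) = left_As ?m ?s"
      by (simp add: row_size_Suc left_As_Suc row_Suc_last)
    also have "(- 1 :: int) ^ left_As ?m ?s = - ((- 1) ^ Suc (left_As ?m ?s))" by simp
    finally show ?thesis unfolding left_As_row_size .
  qed
  finally show ?thesis by simp
qed

text \<open>With \<open>W = 1 - (- 1) ^ row_size (n + 1)\<close>, the relations \<open>B = - alt_sum\<close> and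
  \<open>alt_sum = W + A + B\<close> in row \<open>n + 1\<close> give \<open>A + 2 B = - W\<close>, whatever the value of \<open>alt_sum\<close>.\<close>

lemma alt_sum_recurrence: "alt_sum (n + 4) = 1 - (- 1) ^ row_size (Suc n)"
proof -
  have "B_sum (Suc n) = - alt_sum (Suc n)"
    by (simp add: B_sum_Suc alt_sum_Suc)
  then have "B_sum_by_As (Suc (Suc n)) = - (1 - (- 1) ^ row_size (Suc n))"
    using alt_sum_by_type[of n] by (simp add: B_sum_by_As_Suc)
  then show ?thesis
    using A_sum_by_first_child_Suc_Suc[of "Suc n"] by (simp add: alt_sum_Suc eval_nat_numeral)
qed

lemma alt_sum_initial: "alt_sum 0 = 1" "alt_sum 1 = 0" "alt_sum 2 = 0" "alt_sum 3 = - 2"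
proof -
  show "alt_sum 0 = 1"
    by (simp add: alt_sum_def row_size_def T_left_winger)
  have row_1: "row (Suc 0) = [Winger, Winger]" by (simp add: row_Suc)
  show "alt_sum 1 = 0"
    by (simp add: alt_sum_Suc A_sum_by_first_child_def row_size_def)
  have "alt_sum (Suc (Suc 0)) = 0"
    unfolding alt_sum_Suc A_sum_by_first_child_def row_size_def row_1 by simp
  then show "alt_sum 2 = 0" by (simp add: numeral_2_eq_2)
  have "B_sum_by_As (Suc 0) = 0"
    unfolding B_sum_by_As_def row_size_def row_1 by simp
  then show "alt_sum 3 = - 2"
    using A_sum_by_first_child_Suc_Suc[of 0] by (simp add: alt_sum_Suc numeral_3_eq_3 row_size_def)
qed

theorem theorem3:
  shows "(\<forall>n::nat. n \<ge> 1 \<and> (\<exists>t::int. int n = 3 * t + 1) \<longrightarrow> alt_sum n = 0) \<and>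
         (\<forall>n::nat. n \<ge> 5 \<and> (\<forall>t::int. int n \<noteq> 3 * t + 1) \<longrightarrow> alt_sum n = 2) \<and>
         alt_sum 0 = 1 \<and> alt_sum 2 = 0 \<and> alt_sum 3 = - 2"
proof -
  have residue: "(\<exists>t::int. int n = 3 * t + 1) \<longleftrightarrow> n mod 3 = 1" for n
    by presburger
  have alt_sum_large: "alt_sum n = (if n mod 3 = 1 then 0 else 2)" if n: "4 \<le> n" for n
  proof -
    obtain m where m: "n = m + 4" using le_Suc_ex[OF n] by (auto simp: add.commute)
    have "even (row_size (Suc m)) \<longleftrightarrow> n mod 3 = 1"
      unfolding even_row_size_iff m by presburger
    then show ?thesis by (auto simp: m alt_sum_recurrence)
  qed
  have "alt_sum n = 0" if "n mod 3 = 1" for n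
  proof (cases "4 \<le> n")
    case True
    then show ?thesis using that alt_sum_large by simp
  next
    case False
    then have "n = 1" using that by presburger
    then show ?thesis using alt_sum_initial(2) by simp
  qed
  moreover have "alt_sum n = 2" if "5 \<le> n" "n mod 3 \<noteq> 1" for n
    using that alt_sum_large by simp
  ultimately show ?thesis
    using residue alt_sum_initial by blast
qed

end
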